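(* Let $G$ be a finite nonabelian simple group, $M$ a maximal subgroup of $G$, $g\in M\setminus\{1\}$, and let $\mathcal{D}=(\mathcal{P},\mathcal{B})$ be the $1$-design with $\mathcal{P}=g^G$ and $\mathcal{B}=\{(M\cap g^G)^y:y\in G\}$. For $\phi\in\mathrm{Aut}(G)$, $\widetilde\phi\in\mathrm{Aut}(\mathcal{D})$ if and only if $\phi(g)\in g^G$ and $\phi(M)=M^x$ for some $x\in G$.
   Context: For $u,x\in G$, $u^x=x^{-1}ux$; for a subset (or subgroup) $B$ of $G$, $B^x=\{u^x:u\in B\}$; $g^G$ is the conjugacy class of $g$. $\mathrm{Aut}(\mathcal{D})$ is the group of permutations of $\mathcal{P}$ that map blocks to blocks. For $\phi\in\mathrm{Aut}(G)$, $\widetilde\phi$ is the map defined by $\widetilde\phi(u):=\phi(u)$ for $u\in\mathcal{P}$ and $\widetilde\phi(B):=\{\phi(v):v\in B\}$ for blocks $B$. The statement $\widetilde\phi\in\mathrm{Aut}(\mathcal{D})$ means that $\widetilde\phi$ maps $\mathcal{P}$ onto $\mathcal{P}$ and maps blocks to blocks. *)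

theory Defs
  imports "HOL-Algebra.SimpleGroups" "HOL-Algebra.Bij"
begin

definition maximal_subgroup :: "'a set \<Rightarrow> ('a, 'b) monoid_scheme \<Rightarrow> bool" where
  "maximal_subgroup M G \<longleftrightarrow> subgroup M G \<and> M \<noteq> carrier G \<and>
     (\<forall>H. subgroup H G \<and> M \<subseteq> H \<longrightarrow> H = M \<or> H = carrier G)"

text \<open>Right conjugation: \<open>conj_elem G u x\<close> is \<open>u\<^sup>x = x\<^sup>-\<^sup>1 u x\<close>.\<close>

definition conj_elem :: "('a, 'b) monoid_scheme \<Rightarrow> 'a \<Rightarrow> 'a \<Rightarrow> 'a" where
  "conj_elem G u x = inv\<^bsub>G\<^esub> x \<otimes>\<^bsub>G\<^esub> u \<otimes>\<^bsub>G\<^esub> x"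

definition conj_set :: "('a, 'b) monoid_scheme \<Rightarrow> 'a set \<Rightarrow> 'a \<Rightarrow> 'a set" where
  "conj_set G B x = {conj_elem G u x | u. u \<in> B}"

definition conj_class :: "('a, 'b) monoid_scheme \<Rightarrow> 'a \<Rightarrow> 'a set" where
  "conj_class G g = {conj_elem G g x | x. x \<in> carrier G}"

text \<open>An incidence structure is a pair of a point set and a set of blocks, each block being a
  set of points.\<close>

type_synonym 'a incidence = "'a set \<times> 'a set set"

abbreviation points :: "'a incidence \<Rightarrow> 'a set" where "points \<equiv> fst"
abbreviation blocks :: "'a incidence \<Rightarrow> 'a set set" where "blocks \<equiv> snd"

definition one_design :: "'a incidence \<Rightarrow> bool" where
  "one_design D \<longleftrightarrow> finite (points D) \<and> (\<forall>B \<in> blocks D. B \<subseteq> points D) \<and>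
     (\<exists>k>0. \<forall>B \<in> blocks D. card B = k) \<and>
     (\<exists>r>0. \<forall>p \<in> points D. card {B \<in> blocks D. p \<in> B} = r)"

definition class_design :: "('a, 'b) monoid_scheme \<Rightarrow> 'a set \<Rightarrow> 'a \<Rightarrow> 'a incidence" where
  "class_design G M g =
     (conj_class G g, {conj_set G (M \<inter> conj_class G g) y | y. y \<in> carrier G})"

text \<open>Permutations of the point set are taken as elements of \<^const>\<open>Bij\<close>, i.e. they are
  extensional outside the point set, as for \<^const>\<open>auto\<close>. A permutation acts on
  blocks elementwise.\<close>

definition design_aut :: "'a incidence \<Rightarrow> ('a \<Rightarrow> 'a) set" where
  "design_aut D = {f \<in> Bij (points D). \<forall>B \<in> blocks D. f ` B \<in> blocks D}"

text \<open>The map induced by \<open>\<phi>\<close> is represented by its action on the points; its action on a block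
  is the elementwise one, see \<open>induced_map_block\<close> below.\<close>

definition induced_map :: "'a incidence \<Rightarrow> ('a \<Rightarrow> 'a) \<Rightarrow> 'a \<Rightarrow> 'a" where
  "induced_map D \<phi> = (\<lambda>u \<in> points D. \<phi> u)"

lemma induced_map_block:
  assumes "B \<subseteq> points D"
  shows "induced_map D \<phi> ` B = {\<phi> v | v. v \<in> B}"
  using assms by (auto simp: induced_map_def)

lemma induced_map_in_design_aut_iff:
  assumes "inj_on \<phi> (points D)" and "\<forall>B \<in> blocks D. B \<subseteq> points D"
  shows "induced_map D \<phi> \<in> design_aut D \<longleftrightarrow>
    \<phi> ` points D = points D \<and> (\<forall>B \<in> blocks D. {\<phi> v | v. v \<in> B} \<in> blocks D)"
proof -
  have "induced_map D \<phi> ` B = {\<phi> v | v. v \<in> B}" if "B \<in> blocks D" for B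
    using induced_map_block[of B D \<phi>] that assms(2) by simp
  moreover have "induced_map D \<phi> \<in> Bij (points D) \<longleftrightarrow> \<phi> ` points D = points D"
    using assms(1)
    by (simp add: induced_map_def Bij_def bij_betw_def inj_on_restrict_eq image_restrict_eq)
  ultimately show ?thesis
    by (simp add: design_aut_def)
qed

context group
begin

lemma conj_elem_closed [simp]:
  "u \<in> carrier G \<Longrightarrow> x \<in> carrier G \<Longrightarrow> conj_elem G u x \<in> carrier G"
  by (simp add: conj_elem_def)

lemma conj_elem_conj_elem:
  "u \<in> carrier G \<Longrightarrow> x \<in> carrier G \<Longrightarrow> y \<in> carrier G \<Longrightarrow>
    conj_elem G (conj_elem G u x) y = conj_elem G u (x \<otimes> y)"
  by (simp add: conj_elem_def m_assoc inv_mult_group)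

lemma conj_elem_one [simp]: "u \<in> carrier G \<Longrightarrow> conj_elem G u \<one> = u"
  by (simp add: conj_elem_def)

lemma conj_elem_inv_cancel [simp]:
  "u \<in> carrier G \<Longrightarrow> x \<in> carrier G \<Longrightarrow> conj_elem G (conj_elem G u x) (inv x) = u"
  "u \<in> carrier G \<Longrightarrow> x \<in> carrier G \<Longrightarrow> conj_elem G (conj_elem G u (inv x)) x = u"
  by (simp_all add: conj_elem_conj_elem)

lemma inj_on_conj_elem: "x \<in> carrier G \<Longrightarrow> inj_on (\<lambda>u. conj_elem G u x) (carrier G)"
  by (rule inj_on_inverseI[where g = "\<lambda>u. conj_elem G u (inv x)"]) simp

lemma conj_set_conj_set:
  assumes "B \<subseteq> carrier G" "x \<in> carrier G" "y \<in> carrier G"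
  shows "conj_set G (conj_set G B x) y = conj_set G B (x \<otimes> y)"
proof -
  have "conj_elem G (conj_elem G u x) y = conj_elem G u (x \<otimes> y)" if "u \<in> B" for u
    using that assms conj_elem_conj_elem by blast
  moreover have "conj_set G A z = (\<lambda>u. conj_elem G u z) ` A" for A z
    by (auto simp: conj_set_def)
  ultimately show ?thesis
    by (simp add: image_image)
qed

lemma conj_set_one: "B \<subseteq> carrier G \<Longrightarrow> conj_set G B \<one> = B"
  unfolding conj_set_def by force

lemma card_conj_set:
  assumes "B \<subseteq> carrier G" "x \<in> carrier G"
  shows "card (conj_set G B x) = card B"
proof -
  have "conj_set G B x = (\<lambda>u. conj_elem G u x) ` B"
    by (auto simp: conj_set_def)
  then show ?thesis
    using card_image inj_on_subset[OF inj_on_conj_elem[OF assms(2)] assms(1)] by metis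
qed

lemma one_design_class_design:
  assumes fin: "finite (carrier G)" and M: "subgroup M G" and g: "g \<in> M"
  shows "one_design (class_design G M g)"
proof -
  let ?P = "conj_class G g"
  let ?C = "M \<inter> ?P"
  let ?Bs = "{conj_set G ?C y | y. y \<in> carrier G}"
  have gG: "g \<in> carrier G" using M g subgroup.mem_carrier by metis
  have PG: "?P \<subseteq> carrier G" using gG by (auto simp: conj_class_def)
  then have CG: "?C \<subseteq> carrier G" by blast
  have gP: "g \<in> ?P" unfolding conj_class_def using gG by (auto intro!: exI[of _ \<one>])
  have finP: "finite ?P" using fin PG finite_subset by blast
  have Pconj: "conj_elem G u y \<in> ?P" if "u \<in> ?P" "y \<in> carrier G" for u y
    using that gG unfolding conj_class_def by (auto simp: conj_elem_conj_elem)
  have sub: "\<forall>B \<in> ?Bs. B \<subseteq> ?P"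
    using Pconj by (auto simp: conj_set_def)
  have finBs: "finite ?Bs"
    using sub finP finite_subset[of ?Bs "Pow ?P"] by blast
  have k: "card ?C > 0 \<and> (\<forall>B \<in> ?Bs. card B = card ?C)"
    using card_conj_set[OF CG] finP g gP by (auto simp: card_gt_0_iff)
  have conjB: "conj_set G B x \<in> ?Bs" if "B \<in> ?Bs" "x \<in> carrier G" for B x
    using that conj_set_conj_set[OF CG] by auto
  define d where "d p = {B \<in> ?Bs. p \<in> B}" for p
  have le: "card (d p) \<le> card (d (conj_elem G p x))"
    if p: "p \<in> carrier G" and x: "x \<in> carrier G" for p x
  proof (rule card_inj_on_le[where f = "\<lambda>B. conj_set G B x"])
    show "inj_on (\<lambda>B. conj_set G B x) (d p)"
    proof (rule inj_on_inverseI[where g = "\<lambda>B. conj_set G B (inv x)"])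
      fix B assume "B \<in> d p"
      then have "B \<subseteq> carrier G" using sub PG by (auto simp: d_def)
      then show "conj_set G (conj_set G B x) (inv x) = B"
        using x by (simp add: conj_set_conj_set conj_set_one)
    qed
    show "(\<lambda>B. conj_set G B x) ` d p \<subseteq> d (conj_elem G p x)"
    proof
      fix B' assume "B' \<in> (\<lambda>B. conj_set G B x) ` d p"
      then obtain B where B: "B \<in> ?Bs" "p \<in> B" "B' = conj_set G B x"
        unfolding d_def by blast
      have "B' \<in> ?Bs" using conjB[OF B(1) x] B(3) by simp
      moreover have "conj_elem G p x \<in> B'" using B(2,3) by (auto simp: conj_set_def)
      ultimately show "B' \<in> d (conj_elem G p x)" unfolding d_def by blast
    qed
    show "finite (d (conj_elem G p x))" using finBs by (simp add: d_def)
  qed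
  have r: "card (d p) = card (d g)" if "p \<in> ?P" for p
  proof -
    obtain x where x: "x \<in> carrier G" "p = conj_elem G g x"
      using \<open>p \<in> ?P\<close> unfolding conj_class_def by blast
    have "card (d p) \<le> card (d (conj_elem G p (inv x)))"
      using le[of p "inv x"] x gG by simp
    then show ?thesis using le[OF gG x(1)] x gG by simp
  qed
  have "conj_set G ?C \<one> \<in> d g"
    unfolding d_def using conj_set_one[OF CG] g gP one_closed by blast
  moreover have "finite (d g)" using finBs by (simp add: d_def)
  ultimately have "card (d g) > 0" by (auto simp: card_gt_0_iff)
  then have "\<exists>r>0. \<forall>p \<in> ?P. card {B \<in> ?Bs. p \<in> B} = r"
    using r unfolding d_def by blast
  then show ?thesis
    unfolding one_design_def class_design_def fst_conv snd_conv
    using finP sub k by blast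
qed

end

end

theory Submission
  imports Defs "HOL-Algebra.Generated_Groups"
begin

text \<open>
  Let \<open>C = M \<inter> g\<^sup>G\<close> be the base block. The idea is that the block \<open>C\<close> and the subgroup \<open>M\<close>
  determine each other, compatibly with conjugation and with automorphisms. Intersecting with the
  point set leads from \<open>M\<close> to \<open>C\<close>. In the other direction, \<open>M\<close> is the stabilizer of \<open>C\<close> under
  conjugation (lemma \<open>conj_stabilizer_base_block\<close>): the stabilizer contains \<open>M\<close>, so by maximality
  it could otherwise only be all of \<open>G\<close>; but then \<open>C\<close> would be closed under conjugation, hence
  equal to \<open>g\<^sup>G\<close>, and \<open>M\<close> would contain the nontrivial normal subgroup generated by \<open>g\<^sup>G\<close>,
  contradicting simplicity.

  Forming stabilizers commutes with conjugation and with applying \<open>\<phi>\<close>. So if \<open>\<phi>\<close> maps \<open>C\<close> to a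
  block \<open>C\<^sup>x\<close>, then it maps the stabilizer \<open>M\<close> of \<open>C\<close> to the stabilizer \<open>M\<^sup>x\<close> of \<open>C\<^sup>x\<close>. Conversely,
  \<open>\<phi>(g) \<in> g\<^sup>G\<close> makes \<open>\<phi>\<close> preserve the point set, and then \<open>\<phi>(M) = M\<^sup>x\<close> gives
  \<open>\<phi>(C) = M\<^sup>x \<inter> g\<^sup>G = C\<^sup>x\<close>; every other block is \<open>C\<^sup>y\<close>, which is sent to \<open>\<phi>(C)\<^bsup>\<phi>(y)\<^esup>\<close>.
\<close>

definition conj_stabilizer :: "('a, 'b) monoid_scheme \<Rightarrow> 'a set \<Rightarrow> 'a set" where
  "conj_stabilizer G B = {x \<in> carrier G. conj_set G B x = B}"

lemma conj_set_eq_image: "conj_set G B x = (\<lambda>u. conj_elem G u x) ` B"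
  by (auto simp: conj_set_def)

context group
begin

lemma conj_set_closed:
  "B \<subseteq> carrier G \<Longrightarrow> x \<in> carrier G \<Longrightarrow> conj_set G B x \<subseteq> carrier G"
  unfolding conj_set_eq_image using conj_elem_closed by blast

lemma conj_set_Int:
  assumes "A \<subseteq> carrier G" "B \<subseteq> carrier G" "x \<in> carrier G"
  shows "conj_set G (A \<inter> B) x = conj_set G A x \<inter> conj_set G B x"
  unfolding conj_set_eq_image
  using inj_on_image_Int[OF inj_on_conj_elem[OF assms(3)] assms(1,2)] .

lemma conj_set_eq_iff:
  assumes "A \<subseteq> carrier G" "B \<subseteq> carrier G" "x \<in> carrier G"
  shows "conj_set G A x = B \<longleftrightarrow> A = conj_set G B (inv x)"
  using assms by (auto simp: conj_set_conj_set conj_set_one)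

lemma conj_class_closed: "g \<in> carrier G \<Longrightarrow> conj_class G g \<subseteq> carrier G"
  by (auto simp: conj_class_def)

lemma conj_class_self: "g \<in> carrier G \<Longrightarrow> g \<in> conj_class G g"
  unfolding conj_class_def by (auto intro!: exI[of _ \<one>])

lemma conj_set_conj_class:
  assumes g: "g \<in> carrier G" and x: "x \<in> carrier G"
  shows "conj_set G (conj_class G g) x = conj_class G g"
proof -
  have le: "conj_set G (conj_class G g) y \<subseteq> conj_class G g" if "y \<in> carrier G" for y
    using that g by (auto simp: conj_set_def conj_class_def conj_elem_conj_elem)
  have "conj_set G (conj_set G (conj_class G g) (inv x)) x = conj_class G g"
    using g x conj_class_closed by (simp add: conj_set_conj_set conj_set_one)
  then have "conj_class G g \<subseteq> conj_set G (conj_class G g) x"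
    using le[OF inv_closed[OF x]] unfolding conj_set_eq_image by blast
  then show ?thesis using le[OF x] by blast
qed

lemma conj_class_eqI:
  assumes g: "g \<in> carrier G" and h: "h \<in> conj_class G g"
  shows "conj_class G h = conj_class G g"
proof -
  obtain x where x: "x \<in> carrier G" "h = conj_elem G g x"
    using h by (auto simp: conj_class_def)
  then have hG: "h \<in> carrier G" and g_eq: "g = conj_elem G h (inv x)"
    using g by simp_all
  have "conj_class G a \<subseteq> conj_class G b" if "a \<in> conj_class G b" "b \<in> carrier G" for a b
    using that by (auto simp: conj_class_def conj_elem_conj_elem)
  moreover have "g \<in> conj_class G h" using x(1) g_eq by (auto simp: conj_class_def)
  ultimately show ?thesis using h g hG by blast
qed

lemma subgroup_conj_elem_closed:
  "subgroup H G \<Longrightarrow> u \<in> H \<Longrightarrow> x \<in> H \<Longrightarrow> conj_elem G u x \<in> H"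
  by (simp add: conj_elem_def subgroup.m_closed subgroup.m_inv_closed)

lemma subgroup_conj_set_self:
  assumes H: "subgroup H G" and x: "x \<in> H"
  shows "conj_set G H x = H"
proof
  have sub: "H \<subseteq> carrier G" using H by (rule subgroup.subset)
  show "conj_set G H x \<subseteq> H"
    using subgroup_conj_elem_closed[OF H] x by (auto simp: conj_set_def)
  show "H \<subseteq> conj_set G H x"
  proof
    fix u assume u: "u \<in> H"
    have "conj_elem G u (inv x) \<in> H"
      using subgroup_conj_elem_closed[OF H u] subgroup.m_inv_closed[OF H x] .
    moreover have "u = conj_elem G (conj_elem G u (inv x)) x"
      using u x sub by (simp add: subset_iff)
    ultimately show "u \<in> conj_set G H x" unfolding conj_set_eq_image by blast
  qed
qed

lemma conj_stabilizer_subgroup: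
  assumes B: "B \<subseteq> carrier G"
  shows "subgroup (conj_stabilizer G B) G"
proof (rule subgroupI)
  show "conj_stabilizer G B \<subseteq> carrier G" by (auto simp: conj_stabilizer_def)
  show "conj_stabilizer G B \<noteq> {}"
    using conj_set_one[OF B] by (auto simp: conj_stabilizer_def)
  show "inv x \<in> conj_stabilizer G B" if "x \<in> conj_stabilizer G B" for x
    using that B conj_set_eq_iff[OF B B] by (auto simp: conj_stabilizer_def)
  show "x \<otimes> y \<in> conj_stabilizer G B"
    if "x \<in> conj_stabilizer G B" "y \<in> conj_stabilizer G B" for x y
    using that conj_set_conj_set[OF B, of x y] by (auto simp: conj_stabilizer_def)
qed

text \<open>If \<open>s\<close> fixes \<open>A\<close>, then \<open>s\<^sup>z\<close> fixes \<open>A\<^sup>z\<close>, because \<open>z s\<^sup>z = s z\<close>. Used for \<open>z = x\<close> this is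
  one inclusion, and used for \<open>z = x\<^sup>-\<^sup>1\<close> on the set \<open>B\<^sup>x\<close> it is the other.\<close>

lemma conj_stabilizer_conj_set:
  assumes B: "B \<subseteq> carrier G" and x: "x \<in> carrier G"
  shows "conj_stabilizer G (conj_set G B x) = conj_set G (conj_stabilizer G B) x"
proof -
  have fwd: "conj_elem G s z \<in> conj_stabilizer G (conj_set G A z)"
    if "A \<subseteq> carrier G" "z \<in> carrier G" "s \<in> conj_stabilizer G A" for A z s
  proof -
    have s: "s \<in> carrier G" "conj_set G A s = A"
      using that(3) by (auto simp: conj_stabilizer_def)
    have "z \<otimes> conj_elem G s z = s \<otimes> z"
      using s(1) that(2) by (simp add: conj_elem_def m_assoc[symmetric])
    then have "conj_set G (conj_set G A z) (conj_elem G s z) = conj_set G (conj_set G A s) z"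
      using s(1) that(1,2) by (simp add: conj_set_conj_set)
    then show ?thesis using s that(2) by (simp add: conj_stabilizer_def)
  qed
  show ?thesis
  proof
    show "conj_set G (conj_stabilizer G B) x \<subseteq> conj_stabilizer G (conj_set G B x)"
      using fwd[OF B x] by (auto simp: conj_set_eq_image)
    show "conj_stabilizer G (conj_set G B x) \<subseteq> conj_set G (conj_stabilizer G B) x"
    proof
      fix t assume t: "t \<in> conj_stabilizer G (conj_set G B x)"
      then have tG: "t \<in> carrier G" by (simp add: conj_stabilizer_def)
      have "conj_elem G t (inv x) \<in> conj_stabilizer G B"
        using fwd[OF conj_set_closed[OF B x] inv_closed[OF x] t] B x
        by (simp add: conj_set_conj_set conj_set_one)
      moreover have "t = conj_elem G (conj_elem G t (inv x)) x" using tG x by simp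
      ultimately show "t \<in> conj_set G (conj_stabilizer G B) x"
        unfolding conj_set_eq_image by blast
    qed
  qed
qed

lemma auto_conj_elem:
  assumes \<phi>: "\<phi> \<in> auto G" and u: "u \<in> carrier G" and x: "x \<in> carrier G"
  shows "\<phi> (conj_elem G u x) = conj_elem G (\<phi> u) (\<phi> x)"
proof -
  have "group_hom G G \<phi>"
    using \<phi> is_group by (simp add: auto_def group_hom_def group_hom_axioms_def)
  then show ?thesis
    using u x by (simp add: conj_elem_def group_hom.hom_inv group_hom.hom_mult)
qed

lemma auto_bij_betw: "\<phi> \<in> auto G \<Longrightarrow> bij_betw \<phi> (carrier G) (carrier G)"
  by (simp add: auto_def Bij_def)

lemma auto_conj_set:
  assumes "\<phi> \<in> auto G" "B \<subseteq> carrier G" "x \<in> carrier G"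
  shows "\<phi> ` conj_set G B x = conj_set G (\<phi> ` B) (\<phi> x)"
  using assms by (force simp: conj_set_eq_image image_image auto_conj_elem subset_iff)

lemma auto_conj_class:
  assumes \<phi>: "\<phi> \<in> auto G" and g: "g \<in> carrier G"
  shows "\<phi> ` conj_class G g = conj_class G (\<phi> g)"
proof -
  have class_image: "conj_class G h = (\<lambda>x. conj_elem G h x) ` carrier G" for h
    by (auto simp: conj_class_def)
  have "\<phi> ` conj_class G g = (\<lambda>x. conj_elem G (\<phi> g) (\<phi> x)) ` carrier G"
    using auto_conj_elem[OF \<phi> g] by (auto simp: class_image image_image)
  also have "\<dots> = (\<lambda>x. conj_elem G (\<phi> g) x) ` (\<phi> ` carrier G)"
    by (simp add: image_image)
  finally show ?thesis
    using auto_bij_betw[OF \<phi>] by (simp add: class_image bij_betw_def)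
qed

lemma auto_conj_stabilizer:
  assumes \<phi>: "\<phi> \<in> auto G" and B: "B \<subseteq> carrier G"
  shows "\<phi> ` conj_stabilizer G B = conj_stabilizer G (\<phi> ` B)"
proof -
  have inj: "inj_on \<phi> (carrier G)" and surj: "\<phi> ` carrier G = carrier G"
    using auto_bij_betw[OF \<phi>] by (simp_all add: bij_betw_def)
  have eq: "conj_set G (\<phi> ` B) (\<phi> x) = \<phi> ` B \<longleftrightarrow> conj_set G B x = B" if "x \<in> carrier G" for x
    using inj_on_image_eq_iff[OF inj conj_set_closed[OF B that] B] auto_conj_set[OF \<phi> B that]
    by simp
  have "conj_stabilizer G (\<phi> ` B) = {y \<in> \<phi> ` carrier G. conj_set G (\<phi> ` B) y = \<phi> ` B}"
    by (simp add: conj_stabilizer_def surj)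
  also have "\<dots> = \<phi> ` {x \<in> carrier G. conj_set G (\<phi> ` B) (\<phi> x) = \<phi> ` B}"
    by blast
  also have "\<dots> = \<phi> ` conj_stabilizer G B"
    using eq by (simp add: conj_stabilizer_def cong: conj_cong)
  finally show ?thesis by simp
qed

text \<open>The reason no proper subgroup contains the whole class: the subgroup generated by \<open>g\<^sup>G\<close> is normal, because its generating set is closed under
  conjugation, and it is not trivial, so in a simple group it is everything.\<close>

lemma simple_group_conj_class_subset:
  assumes simple: "simple_group G" and H: "subgroup H G"
    and g: "g \<in> carrier G" "g \<noteq> \<one>" and sub: "conj_class G g \<subseteq> H"
  shows "H = carrier G"
proof -
  let ?P = "conj_class G g"
  have "generate G ?P \<lhd> G"
  proof (rule normal_generateI)
    show "?P \<subseteq> carrier G" using g(1) by (rule conj_class_closed)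
    fix h x assume h: "h \<in> ?P" and x: "x \<in> carrier G"
    have "conj_elem G h (inv x) \<in> ?P"
      using conj_set_conj_class[OF g(1) inv_closed[OF x]] h unfolding conj_set_eq_image by blast
    then show "x \<otimes> h \<otimes> inv x \<in> ?P" using x by (simp add: conj_elem_def)
  qed
  moreover have "generate G ?P \<noteq> {\<one>}"
    using generate.incl[OF conj_class_self[OF g(1)]] g(2) by blast
  ultimately have "generate G ?P = carrier G"
    using simple_group.no_real_normal_subgroup[OF simple] by blast
  then show ?thesis
    using generate_subgroup_incl[OF sub H] subgroup.subset[OF H] by blast
qed

text \<open>Together with maximality of \<open>M\<close>, this is where simplicity enters: no conjugation-invariant
  set through \<open>g\<close> fits inside \<open>M\<close>, so the stabilizer cannot grow beyond \<open>M\<close>.\<close>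

lemma conj_stabilizer_base_block:
  assumes simple: "simple_group G" and M: "maximal_subgroup M G" and g: "g \<in> M - {\<one>}"
  shows "conj_stabilizer G (M \<inter> conj_class G g) = M"
proof -
  let ?C = "M \<inter> conj_class G g"
  let ?N = "conj_stabilizer G ?C"
  have Msub: "subgroup M G" and Mproper: "M \<noteq> carrier G"
    using M by (auto simp: maximal_subgroup_def)
  have MG: "M \<subseteq> carrier G" using Msub by (rule subgroup.subset)
  have gG: "g \<in> carrier G" using g MG by blast
  have PG: "conj_class G g \<subseteq> carrier G" using gG by (rule conj_class_closed)
  have Nsub: "subgroup ?N G" using conj_stabilizer_subgroup MG by blast
  have "M \<subseteq> ?N"
  proof
    fix m assume m: "m \<in> M"
    then have mG: "m \<in> carrier G" using MG by blast
    show "m \<in> ?N"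
      using conj_set_Int[OF MG PG mG] subgroup_conj_set_self[OF Msub m]
        conj_set_conj_class[OF gG mG] mG
      by (simp add: conj_stabilizer_def)
  qed
  moreover have "?N \<noteq> carrier G"
  proof
    assume N: "?N = carrier G"
    have "g \<in> ?C" using g gG conj_class_self by blast
    have "conj_class G g \<subseteq> M"
    proof
      fix u assume "u \<in> conj_class G g"
      then obtain x where x: "x \<in> carrier G" "u = conj_elem G g x"
        by (auto simp: conj_class_def)
      then have "u \<in> conj_set G ?C x" using \<open>g \<in> ?C\<close> unfolding conj_set_eq_image by blast
      moreover have "conj_set G ?C x = ?C" using N x(1) by (auto simp: conj_stabilizer_def)
      ultimately show "u \<in> M" by blast
    qed
    then show False
      using simple_group_conj_class_subset[OF simple Msub gG] g Mproper by blast
  qed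
  ultimately show ?thesis using M Nsub by (auto simp: maximal_subgroup_def)
qed

end

theorem lemma4p1:
  fixes G :: "('a, 'b) monoid_scheme" (structure)
    and M :: "'a set" and g :: 'a and \<phi> :: "'a \<Rightarrow> 'a"
  assumes "simple_group G" and "finite (carrier G)" and "\<not> comm_group G"
    and "maximal_subgroup M G"
    and "g \<in> M - {\<one>}"
    and "\<phi> \<in> auto G"
  shows "induced_map (class_design G M g) \<phi> \<in> design_aut (class_design G M g) \<longleftrightarrow>
    \<phi> g \<in> conj_class G g \<and> (\<exists>x \<in> carrier G. \<phi> ` M = conj_set G M x)"
proof -
  interpret group G using assms(1) by (rule simple_group.axioms(1))
  let ?P = "conj_class G g"
  let ?C = "M \<inter> ?P"
  let ?D = "class_design G M g"
  note \<phi> = \<open>\<phi> \<in> auto G\<close>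
  have inj: "inj_on \<phi> (carrier G)" and surj: "\<phi> ` carrier G = carrier G"
    using auto_bij_betw[OF \<phi>] by (simp_all add: bij_betw_def)
  have MG: "M \<subseteq> carrier G" using assms(4) subgroup.subset by (auto simp: maximal_subgroup_def)
  have gG: "g \<in> carrier G" using assms(5) MG by blast
  have PG: "?P \<subseteq> carrier G" using gG by (rule conj_class_closed)
  have CG: "?C \<subseteq> carrier G" using MG by blast
  have stab: "conj_stabilizer G ?C = M"
    using conj_stabilizer_base_block assms(1,4,5) by blast
  have points: "points ?D = ?P" by (simp add: class_design_def)
  have blocks: "blocks ?D = {conj_set G ?C y | y. y \<in> carrier G}" by (simp add: class_design_def)
  have block_points: "\<forall>B \<in> blocks ?D. B \<subseteq> points ?D"
    using conj_set_Int[OF MG PG] conj_set_conj_class[OF gG] by (auto simp: points blocks)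
  have "induced_map ?D \<phi> \<in> design_aut ?D \<longleftrightarrow>
      \<phi> ` ?P = ?P \<and> (\<forall>B \<in> blocks ?D. \<phi> ` B \<in> blocks ?D)"
    using induced_map_in_design_aut_iff[OF _ block_points, of \<phi>] inj_on_subset[OF inj PG]
    by (simp add: points image_def setcompr_eq_image)
  also have "\<dots> \<longleftrightarrow> \<phi> g \<in> ?P \<and> (\<exists>x \<in> carrier G. \<phi> ` M = conj_set G M x)"
  proof
    assume L: "\<phi> ` ?P = ?P \<and> (\<forall>B \<in> blocks ?D. \<phi> ` B \<in> blocks ?D)"
    \<comment> \<open>The base block alone carries the information about \<open>\<phi>(M)\<close>.\<close>
    have "?C \<in> blocks ?D" using conj_set_one[OF CG] by (force simp: blocks)
    with L obtain x where x: "x \<in> carrier G" "\<phi> ` ?C = conj_set G ?C x"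
      by (auto simp: blocks)
    then have "\<phi> ` M = conj_set G M x"
      using auto_conj_stabilizer[OF \<phi> CG] conj_stabilizer_conj_set[OF CG x(1)] stab by simp
    then show "\<phi> g \<in> ?P \<and> (\<exists>x \<in> carrier G. \<phi> ` M = conj_set G M x)"
      using L x(1) conj_class_self[OF gG] by blast
  next
    assume R: "\<phi> g \<in> ?P \<and> (\<exists>x \<in> carrier G. \<phi> ` M = conj_set G M x)"
    then obtain x where x: "x \<in> carrier G" "\<phi> ` M = conj_set G M x" by blast
    have P: "\<phi> ` ?P = ?P"
      using auto_conj_class[OF \<phi> gG] conj_class_eqI[OF gG] R by simp
    have "\<phi> ` ?C = \<phi> ` M \<inter> \<phi> ` ?P" using inj_on_image_Int[OF inj MG PG] .
    also have "\<dots> = conj_set G ?C x"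
      using conj_set_Int[OF MG PG x(1)] conj_set_conj_class[OF gG x(1)] by (simp add: P x(2))
    finally have C: "\<phi> ` ?C = conj_set G ?C x" .
    have "\<phi> ` conj_set G ?C y \<in> blocks ?D" if y: "y \<in> carrier G" for y
    proof -
      have \<phi>y: "\<phi> y \<in> carrier G" using surj y by blast
      have "\<phi> ` conj_set G ?C y = conj_set G ?C (x \<otimes> \<phi> y)"
        using auto_conj_set[OF \<phi> CG y] C conj_set_conj_set[OF CG x(1) \<phi>y] by simp
      then show ?thesis using x(1) \<phi>y by (auto simp: blocks)
    qed
    then show "\<phi> ` ?P = ?P \<and> (\<forall>B \<in> blocks ?D. \<phi> ` B \<in> blocks ?D)"
      using P by (auto simp: blocks)
  qed
  finally show ?thesis .
qed

end
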